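(* For every finite or infinite sequence $\mathbf f$ over $\{-1,1\}$, the only squares (factors of the form $zz$ with $z$ nonempty) occurring in the run-length sequence $R_{\mathbf f}$ are among $22$, $123123$, and $321321$.
   Context: For a finite sequence $\mathbf f$ over $\{-1,1\}$ define $P_\epsilon=\epsilon$ (empty) and $P_{\mathbf f a}=P_{\mathbf f}\ a\ (-P_{\mathbf f}^R)$ for $a\in\{-1,1\}$, where $-x$ negates every entry and $x^R$ is reversal. For an infinite $\mathbf f=f_0f_1\cdots$, $P_{\mathbf f}$ is the unique infinite sequence having every $P_{f_0\cdots f_n}$ as a prefix. A run is a maximal block of consecutive identical entries; the run-length sequence $R_{\mathbf f}$ is the sequence of lengths of the runs of $P_{\mathbf f}$ from left to right (a word over $\{1,2,3\}$). A factor is a contiguous block. *)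

theory Defs
  imports Main "HOL-Library.Sublist"
begin

text \<open>
  Finite words are lists and infinite words are functions on \<^typ>\<open>nat\<close>. The alphabet
  \<open>{-1, 1}\<close> lives inside \<^typ>\<open>int\<close>; membership in it is a hypothesis wherever it matters.
\<close>

text \<open>The letters of the instruction word are consumed from left to right, so that appending a
  letter \<open>a\<close> to \<open>f\<close> turns \<open>P\<close> into \<open>P a (-P\<^sup>R)\<close>; see \<open>paperfold_snoc\<close>.\<close>

definition paperfold :: "int list \<Rightarrow> int list" where
  "paperfold f = foldl (\<lambda>p a. p @ [a] @ map uminus (rev p)) [] f"

lemma paperfold_Nil [simp]: "paperfold [] = []"
  by (simp add: paperfold_def)

lemma paperfold_snoc [simp]:
  "paperfold (f @ [a]) = paperfold f @ [a] @ map uminus (rev (paperfold f))"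
  by (simp add: paperfold_def)

definition prefix_inf :: "'a list \<Rightarrow> (nat \<Rightarrow> 'a) \<Rightarrow> bool" where
  "prefix_inf w p \<longleftrightarrow> (\<forall>i < length w. p i = w ! i)"

definition paperfold_inf :: "(nat \<Rightarrow> int) \<Rightarrow> (nat \<Rightarrow> int)" where
  "paperfold_inf f = (THE p. \<forall>n. prefix_inf (paperfold (map f [0..<Suc n])) p)"

function run_lengths :: "'a list \<Rightarrow> nat list" where
  "run_lengths [] = []"
| "run_lengths (x # xs) =
     Suc (length (takeWhile (\<lambda>y. y = x) xs)) # run_lengths (dropWhile (\<lambda>y. y = x) xs)"
  by pat_completeness auto
termination
  by (relation "measure length") (auto simp: less_Suc_eq_le length_dropWhile_le)

text \<open>Start positions of the successive runs of an infinite word. They are meaningful only if every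
  run is finite, which holds for paperfolding words by \<open>paperfold_inf_changes\<close>.\<close>

primrec run_start :: "(nat \<Rightarrow> 'a) \<Rightarrow> nat \<Rightarrow> nat" where
  "run_start p 0 = 0"
| "run_start p (Suc k) = (LEAST j. run_start p k < j \<and> p j \<noteq> p (run_start p k))"

definition run_lengths_inf :: "(nat \<Rightarrow> 'a) \<Rightarrow> (nat \<Rightarrow> nat)" where
  "run_lengths_inf p k = run_start p (Suc k) - run_start p k"

text \<open>For finite words, factors are given by \<^const>\<open>sublist\<close>, which is contiguous.\<close>

definition factor_inf :: "'a list \<Rightarrow> (nat \<Rightarrow> 'a) \<Rightarrow> bool" where
  "factor_inf w r \<longleftrightarrow> (\<exists>i. w = map r [i..<i + length w])"

lemma length_paperfold: "Suc (length (paperfold f)) = 2 ^ length f"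
  by (induction f rule: rev_induct) auto

lemma paperfold_map_Suc:
  "paperfold (map f [0..<Suc n]) =
     paperfold (map f [0..<n]) @ [f n] @ map uminus (rev (paperfold (map f [0..<n])))"
  by simp

lemma prefix_paperfold:
  assumes "m \<le> n"
  shows "prefix (paperfold (map f [0..<m])) (paperfold (map f [0..<n]))"
  using assms
proof (induction rule: dec_induct)
  case (step k)
  then show ?case
    unfolding paperfold_map_Suc by (meson prefix_order.trans prefixI)
qed simp

lemma length_paperfold_gt: "i < length (paperfold (map f [0..<Suc i]))"
proof -
  have "Suc i < 2 ^ Suc i"
    by (rule less_exp)
  moreover have "Suc (length (paperfold (map f [0..<Suc i]))) = 2 ^ Suc i"
    by (simp only: length_paperfold length_map length_upt diff_zero)
  ultimately show ?thesis
    by linarith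
qed

lemma paperfold_inf_ex1: "\<exists>!p. \<forall>n. prefix_inf (paperfold (map f [0..<Suc n])) p"
proof (rule ex1I)
  let ?w = "\<lambda>n. paperfold (map f [0..<Suc n])"
  show "\<forall>n. prefix_inf (?w n) (\<lambda>i. ?w i ! i)"
    unfolding prefix_inf_def
  proof (intro allI impI)
    fix n i
    assume i: "i < length (?w n)"
    have "prefix (?w i) (?w n) \<or> prefix (?w n) (?w i)"
      by (metis nat_le_linear Suc_le_mono prefix_paperfold)
    then show "?w i ! i = ?w n ! i"
      using i length_paperfold_gt[of i f] by (auto simp: prefix_def nth_append simp del: upt_Suc)
  qed
next
  fix p
  assume "\<forall>n. prefix_inf (paperfold (map f [0..<Suc n])) p"
  then show "p = (\<lambda>i. paperfold (map f [0..<Suc i]) ! i)"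
    using length_paperfold_gt unfolding prefix_inf_def by blast
qed

lemma prefix_paperfold_inf: "prefix_inf (paperfold (map f [0..<n])) (paperfold_inf f)"
proof (cases n)
  case 0
  then show ?thesis by (simp add: prefix_inf_def)
next
  case (Suc m)
  then show ?thesis
    using theI'[OF paperfold_inf_ex1[of f]] unfolding paperfold_inf_def by blast
qed

lemma paperfold_inf_0: "paperfold_inf f 0 = f 0"
  using prefix_paperfold_inf[of f 1] by (simp add: prefix_inf_def paperfold_def)

lemma paperfold_inf_reflect:
  assumes "i < 2 ^ n - 1"
  shows "paperfold_inf f (2 ^ n + i) = - paperfold_inf f (2 ^ n - 2 - i)"
proof -
  let ?w = "paperfold (map f [0..<n])"
  let ?v = "paperfold (map f [0..<Suc n])"
  have len: "length ?w = 2 ^ n - 1"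
    using length_paperfold[of "map f [0..<n]"] by simp
  have v: "?v = (?w @ [f n]) @ map uminus (rev ?w)"
    by simp
  have 1: "2 ^ n + i < length ?v"
    unfolding v using assms len by simp
  have 2: "2 ^ n - 2 - i < length ?w"
    using assms len by linarith
  have "paperfold_inf f (2 ^ n + i) = ?v ! (2 ^ n + i)"
    using prefix_paperfold_inf[of f "Suc n"] 1 unfolding prefix_inf_def by blast
  also have "\<dots> = map uminus (rev ?w) ! i"
  proof -
    have "length (?w @ [f n]) = 2 ^ n"
      using len by simp
    then show ?thesis
      unfolding v by (metis nth_append_length_plus)
  qed
  also have "\<dots> = - (?w ! (2 ^ n - 2 - i))"
    using assms len by (simp add: rev_nth numeral_2_eq_2)
  also have "?w ! (2 ^ n - 2 - i) = paperfold_inf f (2 ^ n - 2 - i)"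
    using prefix_paperfold_inf[of f n] 2 unfolding prefix_inf_def by simp
  finally show ?thesis .
qed

lemma paperfold_inf_changes:
  assumes "range f \<subseteq> {-1, 1}"
  shows "\<exists>j>i. paperfold_inf f j \<noteq> paperfold_inf f i"
proof -
  have "f 0 \<in> {-1, 1}"
    using assms by blast
  then have nz: "f 0 \<noteq> 0"
    by auto
  have last: "paperfold_inf f (2 ^ Suc n - 2) = - f 0" if "n \<ge> 1" for n
  proof -
    have "(2::nat) ^ n \<ge> 2"
      using that by (metis one_le_numeral power_increasing power_one_right)
    then show ?thesis
      using paperfold_inf_reflect[of "2 ^ n - 2" n f] by (simp add: paperfold_inf_0 mult_2)
  qed
  define n where "n = i + 3"
  have big: "2 ^ n > i + 3"
    unfolding n_def by (rule less_exp)
  have "paperfold_inf f (2 ^ n) = - paperfold_inf f (2 ^ n - 2)"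
    using paperfold_inf_reflect[of 0 n f] big by simp
  moreover have "paperfold_inf f (2 ^ n - 2) = - f 0"
    using last[of "i + 2"] by (simp add: n_def power_add mult.commute)
  ultimately have "paperfold_inf f (2 ^ n) \<noteq> paperfold_inf f (2 ^ n - 2)"
    using nz by simp
  moreover have "2 ^ n > i" "2 ^ n - 2 > i"
    using big by linarith+
  ultimately show ?thesis
    by metis
qed

text \<open>The runs of an infinite word without an infinite run: the \<open>k\<close>-th run is the block of
  positions from \<open>run_start p k\<close> up to, but excluding, \<open>run_start p (Suc k)\<close>.\<close>

lemma run_start_Suc:
  assumes "\<And>i. \<exists>j>i. p j \<noteq> p i"
  shows "run_start p k < run_start p (Suc k)"
    and "p (run_start p (Suc k)) \<noteq> p (run_start p k)"
    and "\<And>i. run_start p k \<le> i \<Longrightarrow> i < run_start p (Suc k) \<Longrightarrow> p i = p (run_start p k)"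
proof -
  let ?Q = "\<lambda>j. run_start p k < j \<and> p j \<noteq> p (run_start p k)"
  have eq: "run_start p (Suc k) = (LEAST j. ?Q j)"
    by simp
  have "?Q (LEAST j. ?Q j)"
    using LeastI_ex[of ?Q] assms by blast
  then show "run_start p k < run_start p (Suc k)" "p (run_start p (Suc k)) \<noteq> p (run_start p k)"
    unfolding eq by blast+
  show "p i = p (run_start p k)" if "run_start p k \<le> i" "i < run_start p (Suc k)" for i
    using that not_less_Least[of i ?Q] unfolding eq by (cases "i = run_start p k") auto
qed

end

theory Submission
  imports Defs
begin

text \<open>
  Index the letters of the paperfolding word \<open>p\<close> from 1. Its odd positions alternate in sign, so for
  \<open>i \<ge> 1\<close> exactly one run starts at \<open>2i\<close> or \<open>2i + 1\<close>. Let \<open>E i\<close> be \<open>-1\<close> or \<open>1\<close> accordingly, with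
  \<open>E 0 = 1\<close>. The \<open>i\<close>-th run, counted from 0, has length \<open>2 + (E (i + 1) - E i) / 2\<close>, whence a square
  \<open>zz\<close> with \<open>|z| = n\<close> in the run lengths forces an overlap in \<open>E\<close>, that is, \<open>n + 1\<close> consecutive
  indices \<open>j\<close> with \<open>E (j + n) = E j\<close>. But \<open>E\<close> is, up to signs, again of paperfolding type: for every
  \<open>k\<close>, its values at the odd multiples of \<open>2\<^sup>k\<close> alternate in sign. Squares of odd period \<open>n \<ge> 7\<close>
  are impossible: the alternation at odd positions would carry over to three consecutive even
  positions \<open>k\<close>, \<open>k + 2\<close>, \<open>k + 4\<close> with \<open>k\<close> twice an odd number, but \<open>E (k + 4) = - E k\<close>. Halving
  excludes even periods, and an overlap cannot have period 5.
\<close>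

section \<open>Overlaps in sequences of paperfolding type\<close>

text \<open>Nonvanishing turns \<open>E x = - E x\<close> into a contradiction. Every positive index
  has the form \<open>2 ^ k * j\<close> with \<open>j\<close> odd, so only \<open>E 0\<close> is
  unconstrained.\<close>

definition dyadic_alternating :: "(nat \<Rightarrow> int) \<Rightarrow> bool" where
  "dyadic_alternating E \<longleftrightarrow>
     (\<forall>k j. odd j \<longrightarrow> E (2 ^ k * (j + 2)) = - E (2 ^ k * j) \<and> E (2 ^ k * j) \<noteq> 0)"

text \<open>Doubling the index shifts the level \<open>k\<close> by one; this allows even periods to
  be halved.\<close>

lemma dyadic_alternating_even_part:
  assumes "dyadic_alternating E"
  shows "dyadic_alternating (\<lambda>i. E (2 * i))"
  unfolding dyadic_alternating_def
proof (intro allI impI)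
  fix k j :: nat
  assume "odd j"
  from assms[unfolded dyadic_alternating_def, rule_format, OF this, of "Suc k"]
  show "E (2 * (2 ^ k * (j + 2))) = - E (2 * (2 ^ k * j)) \<and> E (2 * (2 ^ k * j)) \<noteq> 0"
    unfolding power_Suc mult.assoc .
qed

lemma dyadic_alternating_odd:
  assumes "dyadic_alternating E" "odd j"
  shows "E (j + 2) = - E j" "E j \<noteq> 0"
  using assms(1)[unfolded dyadic_alternating_def, rule_format, OF assms(2), of 0] by simp_all

lemma dyadic_alternating_odd4:
  assumes "dyadic_alternating E" "odd j"
  shows "E (j + 4) = E j"
proof -
  have "E ((j + 2) + 2) = E j"
    using dyadic_alternating_odd(1)[OF assms] dyadic_alternating_odd(1)[OF assms(1), of "j + 2"]
      assms(2) by simp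
  moreover have "(j + 2) + 2 = j + 4"
    by simp
  ultimately show ?thesis
    by metis
qed

lemma dyadic_alternating_mod4:
  assumes "dyadic_alternating E" "k mod 4 = 2"
  shows "E (k + 4) = - E k" "E k \<noteq> 0"
proof -
  have j: "k = 2 * (k div 2)" "odd (k div 2)"
    using assms(2) by presburger+
  have "E (2 * (k div 2 + 2)) = - E (2 * (k div 2))" "E (2 * (k div 2)) \<noteq> 0"
    using dyadic_alternating_odd[OF dyadic_alternating_even_part[OF assms(1)] j(2)] by simp_all
  moreover have "2 * (k div 2 + 2) = k + 4"
    using j(1) by simp
  ultimately show "E (k + 4) = - E k" "E k \<noteq> 0"
    using j(1) by metis+
qed

lemma not_alternating_mod4:
  assumes "dyadic_alternating E" "k mod 4 = 2" "E (k + 4) = E k"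
  shows False
  using dyadic_alternating_mod4[OF assms(1,2)] assms(3) by simp

section \<open>Periods of squares and overlaps\<close>

text \<open>Position \<open>k + n\<close> is odd, so \<open>E\<close> has the same value there and 4
  further on. The square carries this equality back to \<open>k\<close> and \<open>k + 4\<close>,
  where the signs must differ.\<close>

lemma square_left_window:
  assumes E: "dyadic_alternating E" and n: "odd n"
    and sq: "\<And>j. i \<le> j \<Longrightarrow> j < i + n \<Longrightarrow> E (j + n) = E j"
    and k: "k mod 4 = 2" "i \<le> k" "k + 4 < i + n"
  shows False
proof -
  have "odd (k + n)"
    using k(1) n by presburger
  from dyadic_alternating_odd4[OF E this] have "E (k + n + 4) = E (k + n)" .
  moreover have "E (k + n) = E k" "E (k + n + 4) = E (k + 4)"
    using sq[of k] sq[of "k + 4"] k by (simp_all add: ac_simps)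
  ultimately show False
    using not_alternating_mod4[OF E k(1)] by simp
qed

text \<open>The same conflict with the halves of the square exchanged: here \<open>k\<close> is odd
  and \<open>k + n\<close> is twice an odd number.\<close>

lemma square_right_window:
  assumes E: "dyadic_alternating E" and n: "odd n"
    and sq: "\<And>j. i \<le> j \<Longrightarrow> j < i + n \<Longrightarrow> E (j + n) = E j"
    and k: "(k + n) mod 4 = 2" "i \<le> k" "k + 4 < i + n"
  shows False
proof -
  have "odd (k)"
    using k(1) n by presburger
  from dyadic_alternating_odd4[OF E this] have "E (k + 4) = E (k)" .
  moreover have "E (k + n) = E k" "E (k + n + 4) = E (k + 4)"
    using sq[of k] sq[of "k + 4"] k by (simp_all add: ac_simps)
  ultimately show False
    using not_alternating_mod4[OF E k(1)] by simp
qed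

lemma odd_square_period:
  assumes E: "dyadic_alternating E" and n: "odd n"
    and sq: "\<And>j. i \<le> j \<Longrightarrow> j < i + n \<Longrightarrow> E (j + n) = E j"
  shows "n \<le> 5"
proof (rule ccontr)
  assume "\<not> n \<le> 5"
  then have n7: "n \<ge> 7"
    using n by presburger
  have L: "k mod 4 \<noteq> 2" if "i \<le> k" "k + 4 < i + n" for k
    using square_left_window[OF E n sq] that by metis
  have R: "(k + n) mod 4 \<noteq> 2" if "i \<le> k" "k + 4 < i + n" for k
    using square_right_window[OF E n sq] that by metis
  \<comment> \<open>As \<open>n\<close> is at least 7, the window fits at three consecutive starts,
    which leaves one residue for \<open>i\<close>. Then \<open>i + n\<close> and
    \<open>i + 2 + n\<close> are consecutive even numbers, so one of them is twice an odd
    number.\<close>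
  have "i mod 4 \<noteq> 2" "(i + 1) mod 4 \<noteq> 2" "(i + 2) mod 4 \<noteq> 2"
    using L[of i] L[of "i + 1"] L[of "i + 2"] n7 by simp_all
  then have "i mod 4 = 3"
    by presburger
  then have "(i + n) mod 4 = 2 \<or> (i + 2 + n) mod 4 = 2"
    using n by presburger
  then show False
    using R[of i] R[of "i + 2"] n7 by auto
qed

lemma square_period:
  assumes "dyadic_alternating E" "n > 0"
    and "\<And>j. i \<le> j \<Longrightarrow> j < i + n \<Longrightarrow> E (j + n) = E j"
  shows "odd n \<and> n \<le> 5"
  using assms
proof (induction n arbitrary: E i rule: less_induct)
  case (less n)
  show ?case
  proof (cases "odd n")
    case True
    then show ?thesis
      using odd_square_period less.prems by blast
  next
    case False
    then obtain m where m: "n = 2 * m"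
      by blast
    \<comment> \<open>\<open>(i + 1) div 2\<close> is half of \<open>i\<close> rounded up, so
      \<open>2 * j\<close> runs over the even positions in the first half of the square.\<close>
    have "E (2 * (j + m)) = E (2 * j)" if "(i + 1) div 2 \<le> j" "j < (i + 1) div 2 + m" for j
      using less.prems(3)[of "2 * j"] that m by (simp add: algebra_simps)
    then have "odd m"
      using less.IH[of m, OF _ dyadic_alternating_even_part[OF less.prems(1)]] less.prems(2) m
      by auto
    \<comment> \<open>At an odd position, a shift by \<open>n = 2 * m\<close> with \<open>m\<close>
      odd flips the sign an odd number of times, against the square.\<close>
    define j where "j = (if odd i then i else Suc i)"
    have j: "odd j" "i \<le> j" "j < i + n"
      using less.prems(2) m by (auto simp: j_def)
    have flip: "E (j + 2 * t) = (- 1) ^ t * E j" for t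
    proof (induction t)
      case (Suc t)
      have "odd (j + 2 * t)"
        using j by simp
      from dyadic_alternating_odd(1)[OF less.prems(1) this] Suc show ?case
        by (simp add: algebra_simps)
    qed simp
    have "E (j + n) = - E j"
      using flip[of m] \<open>odd m\<close> m by simp
    then show ?thesis
      using less.prems(3)[OF j(2,3)] dyadic_alternating_odd(2)[OF less.prems(1) j(1)] by simp
  qed
qed

lemma overlap_period:
  assumes E: "dyadic_alternating E" and n: "n > 0"
    and ov: "\<And>j. i \<le> j \<Longrightarrow> j \<le> i + n \<Longrightarrow> E (j + n) = E j"
  shows "n = 1 \<or> n = 3"
proof -
  have "odd n" "n \<le> 5"
    using square_period[OF E n, of i] ov by simp_all
  moreover have False if n5: "n = 5"
  proof -
    have e: "E (i + 5) = E i" "E (i + 6) = E (i + 1)" "E (i + 7) = E (i + 2)"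
      "E (i + 8) = E (i + 3)" "E (i + 9) = E (i + 4)" "E (i + 10) = E (i + 5)"
      using ov[of i] ov[of "i + 1"] ov[of "i + 2"] ov[of "i + 3"] ov[of "i + 4"] ov[of "i + 5"]
      by (simp_all add: n5 numeral_eq_Suc)
    have A: "E l = - E j" if "odd j" "l = j + 2" for j l
      using dyadic_alternating_odd(1)[OF E] that by simp
    show False
    proof (cases "odd i")
      case True
      then have "E (i + 2) = - E i" "E (i + 4) = - E (i + 2)" "E (i + 6) = - E (i + 4)"
        "E (i + 8) = - E (i + 6)" "E (i + 10) = - E (i + 8)"
        by - (rule A; simp)+
      then show False
        using e dyadic_alternating_odd(2)[OF E True] by simp
    next
      case False
      then have o: "E (i + 3) = - E (i + 1)" "E (i + 5) = - E (i + 3)" "E (i + 7) = - E (i + 5)"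
        "E (i + 9) = - E (i + 7)"
        by - (rule A; simp)+
      have nz: "E (i + 1) \<noteq> 0"
        using dyadic_alternating_odd(2)[OF E] False by simp
      have "i mod 4 = 2 \<or> (i + 6) mod 4 = 2"
        using False by presburger
      then consider "i mod 4 = 2" | "(i + 6) mod 4 = 2"
        by blast
      then show False
      proof cases
        case 1
        have "E (i + 4) = E i"
          using e o by linarith
        then show False
          using not_alternating_mod4[OF E 1] by blast
      next
        case 2
        have "i + 6 + 4 = i + 10"
          by simp
        moreover have "E (i + 10) = E (i + 6)"
          using e o by linarith
        ultimately show False
          using not_alternating_mod4[OF E 2] by metis
      qed
    qed
  qed
  ultimately show ?thesis
    by presburger
qed

text \<open>This fixes three consecutive values up to a common sign, hence the two possible squares
  of period 3. For odd \<open>i\<close>, three sign flips from \<open>i\<close> to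
  \<open>i + 6\<close> contradict \<open>E (i + 6) = E i\<close>.\<close>

lemma overlap_period_3:
  assumes E: "dyadic_alternating E"
    and ov: "\<And>j. i \<le> j \<Longrightarrow> j \<le> i + 3 \<Longrightarrow> E (j + 3) = E j"
  shows "E (i + 1) = - E i" "E (i + 2) = - E i"
proof -
  have e: "E (i + 3) = E i" "E (i + 4) = E (i + 1)" "E (i + 5) = E (i + 2)" "E (i + 6) = E (i + 3)"
    using ov[of i] ov[of "i + 1"] ov[of "i + 2"] ov[of "i + 3"] by (simp_all add: numeral_eq_Suc)
  have A: "E l = - E j" if "odd j" "l = j + 2" for j l
    using dyadic_alternating_odd(1)[OF E] that by simp
  have "even i"
  proof (rule ccontr)
    assume i: "odd i"
    then have "E (i + 2) = - E i" "E (i + 4) = - E (i + 2)" "E (i + 6) = - E (i + 4)"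
      by - (rule A; simp)+
    then show False
      using e dyadic_alternating_odd(2)[OF E i] by simp
  qed
  then have "E (i + 3) = - E (i + 1)" "E (i + 5) = - E (i + 3)"
    by - (rule A; simp)+
  then show "E (i + 1) = - E i" "E (i + 2) = - E i"
    using e by simp_all
qed

section \<open>Run lengths of infinite paperfolding words\<close>

lemma paperfold_inf_power:
  "paperfold_inf f (2 ^ k - 1) = f k"
proof -
  have len: "length (paperfold (map f [0..<k])) = 2 ^ k - 1"
    using length_paperfold[of "map f [0..<k]"] by simp
  have "paperfold_inf f (2 ^ k - 1) = paperfold (map f [0..<Suc k]) ! (2 ^ k - 1)"
    using prefix_paperfold_inf[of f "Suc k"] len unfolding prefix_inf_def by (simp add: less_diff_conv)
  also have "\<dots> = f k"
    by (simp add: nth_append len)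
  finally show ?thesis .
qed

text \<open>With positions counted from 1, reflection in \<open>2 ^ n\<close> negates letters. It
  sends \<open>2 ^ k * (2 * m + 1)\<close> to \<open>2 ^ k * (2 * m' + 1)\<close> with
  \<open>m'\<close> smaller and of opposite parity, so strong induction applies.\<close>

lemma paperfold_inf_closed_form:
  "paperfold_inf f (2 ^ k * (2 * m + 1) - 1) = (- 1) ^ m * f k"
proof (induction m rule: less_induct)
  case (less m)
  show ?case
  proof (cases "m = 0")
    case True
    then show ?thesis
      using paperfold_inf_power[of f k] by simp
  next
    case False
    obtain l where l: "2 ^ l \<le> m" "m < 2 ^ Suc l"
      using False ex_power_ivl1[of 2 m] by auto
    define m' where "m' = 2 ^ Suc l - m - 1"
    have m': "m + m' + 1 = 2 ^ Suc l" "m' < m"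
      using l by (auto simp: m'_def)
    \<comment> \<open>\<open>2 ^ n\<close> is the largest power of two below the position
      \<open>2 ^ k * (2 * m + 1)\<close>.\<close>
    define n where "n = k + Suc l"
    have n: "(2::nat) ^ n = 2 ^ k * (m + m' + 1)"
      unfolding m'(1) n_def by (rule power_add)
    define i where "i = 2 ^ k * (m - m') - 1"
    have pos: "(2::nat) ^ k * (m - m') > 0"
      using m' by simp
    have 1: "2 ^ n + i = 2 ^ k * (2 * m + 1) - 1"
    proof -
      have "2 ^ k * (m + m' + 1) + 2 ^ k * (m - m') = (2 ^ k * (2 * m + 1) :: nat)"
        using m'(2) by (simp flip: distrib_left)
      then show ?thesis
        unfolding n i_def using pos by linarith
    qed
    have 2: "2 ^ n - 2 - i = 2 ^ k * (2 * m' + 1) - 1"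
    proof -
      have "2 ^ k * (2 * m' + 1) + 2 ^ k * (m - m') = (2 ^ k * (m + m' + 1) :: nat)"
        using m'(2) by (simp flip: distrib_left)
      then show ?thesis
        unfolding n i_def using pos by linarith
    qed
    have 3: "i < 2 ^ n - 1"
    proof -
      have "2 ^ k * (m - m') < (2 ^ k * (m + m' + 1) :: nat)"
        by (intro mult_strict_left_mono) auto
      then show ?thesis
        unfolding n i_def using pos by linarith
    qed
    have "even (m + m' + 1)"
      unfolding m'(1) by simp
    then have "(- 1 :: int) ^ m = - ((- 1) ^ m')"
      by (cases "even m") auto
    then show ?thesis
      using paperfold_inf_reflect[OF 3, of f] less.IH[OF m'(2)] unfolding 1 2 by simp
  qed
qed

section \<open>The sequence of run shifts\<close>

text \<open>The value at 0 is chosen so that \<open>run_start_paperfold_inf\<close> also holds for the first run.\<close>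

definition run_shift :: "(nat \<Rightarrow> int) \<Rightarrow> nat \<Rightarrow> int" where
  "run_shift f i = (if i = 0 then 1 else f 0 * (- 1) ^ (i - 1) * paperfold_inf f (2 * i - 1))"

lemma sign_sequence:
  assumes "range f \<subseteq> {-1, 1 :: int}"
  shows "f k = 1 \<or> f k = - 1"
  using assms by blast

lemma paperfold_inf_even: "paperfold_inf f (2 * m) = (- 1) ^ m * f 0"
  using paperfold_inf_closed_form[of f 0 m] by simp

text \<open>The factor \<open>(- 1) ^ (i - 1)\<close> is constant on the odd multiples of a fixed
  \<open>2 ^ k\<close>, so the alternation given by the closed form survives.\<close>

lemma run_shift_odd_multiple:
  "run_shift f (2 ^ k * (2 * m + 1)) = (if k = 0 then 1 else - 1) * f 0 * ((- 1) ^ m * f (Suc k))"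
proof -
  have "paperfold_inf f (2 * (2 ^ k * (2 * m + 1)) - 1) = (- 1) ^ m * f (Suc k)"
    using paperfold_inf_closed_form[of f "Suc k" m] by (simp only: power_Suc mult.assoc)
  moreover have "(- 1 :: int) ^ (2 ^ k * (2 * m + 1) - 1) = (if k = 0 then 1 else - 1)"
    by (cases k) auto
  ultimately show ?thesis
    unfolding run_shift_def by simp
qed

lemma dyadic_alternating_run_shift:
  assumes "range f \<subseteq> {-1, 1}"
  shows "dyadic_alternating (run_shift f)"
  unfolding dyadic_alternating_def
proof (intro allI impI)
  fix k j :: nat
  assume "odd j"
  then obtain m where m: "j = 2 * m + 1"
    by (rule oddE)
  have j2: "j + 2 = 2 * Suc m + 1"
    using m by simp
  have "f 0 \<noteq> 0" "f (Suc k) \<noteq> 0"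
    using sign_sequence[OF assms, of 0] sign_sequence[OF assms, of "Suc k"] by auto
  then show "run_shift f (2 ^ k * (j + 2)) = - run_shift f (2 ^ k * j) \<and> run_shift f (2 ^ k * j) \<noteq> 0"
    unfolding j2 unfolding m run_shift_odd_multiple by simp
qed

lemma nat_power2_odd_decomp:
  fixes i :: nat
  assumes "i \<noteq> 0"
  shows "\<exists>k m. i = 2 ^ k * (2 * m + 1)"
  using assms
proof (induction i rule: less_induct)
  case (less i)
  show ?case
  proof (cases "even i")
    case True
    then obtain h where h: "i = 2 * h"
      by blast
    then obtain k m where "h = 2 ^ k * (2 * m + 1)"
      using less.IH[of h] less.prems by auto
    then have "i = 2 ^ Suc k * (2 * m + 1)"
      using h by simp
    then show ?thesis
      by blast
  next
    case False
    then show ?thesis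
      by (metis oddE power_0 mult_1)
  qed
qed

lemma run_shift_sign:
  assumes "range f \<subseteq> {-1, 1}"
  shows "run_shift f i = 1 \<or> run_shift f i = - 1"
proof (cases "i = 0")
  case False
  then obtain k m where i: "i = 2 ^ k * (2 * m + 1)"
    using nat_power2_odd_decomp by blast
  then show ?thesis
    using sign_sequence[OF assms, of 0] sign_sequence[OF assms, of "Suc k"]
    unfolding i run_shift_odd_multiple by (cases "even m") auto
qed (simp add: run_shift_def)

text \<open>Letters at even indices (from 0) alternate, so the letter at \<open>2 * i + 1\<close>
  agrees with exactly one neighbour and the next run starts there or one later. The second conjunct
  carries the induction: it puts index \<open>2 * i\<close> into the run.\<close>

lemma run_start_paperfold_inf:
  assumes f: "range f \<subseteq> {-1, 1}"
  shows "run_start (paperfold_inf f) i = (if run_shift f i = 1 then 2 * i else 2 * i - 1) \<and>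
    paperfold_inf f (run_start (paperfold_inf f) i) = paperfold_inf f (2 * i)"
proof (induction i)
  case 0
  then show ?case
    by (simp add: run_shift_def)
next
  case (Suc i)
  let ?p = "paperfold_inf f" and ?s = "run_start (paperfold_inf f)"
  have f0: "f 0 = 1 \<or> f 0 = - 1"
    using sign_sequence[OF f] .
  have p0: "?p (2 * i) = (- 1) ^ i * f 0" and p2: "?p (2 * i + 2) = - ((- 1) ^ i * f 0)"
    using paperfold_inf_even[of f i] paperfold_inf_even[of f "Suc i"] by simp_all
  \<comment> \<open>The sign factor in \<open>run_shift\<close> is the letter at
    \<open>2 * i\<close>, so the product is 1 exactly when the letter at \<open>2 * i + 1\<close>
    repeats it.\<close>
  have shift: "run_shift f (Suc i) = ?p (2 * i) * ?p (2 * i + 1)"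
    unfolding p0 by (simp add: run_shift_def)
  have ps: "?p (?s i) = ?p (2 * i)"
    using Suc.IH by blast
  have s: "?s i \<le> 2 * i" "?s i \<ge> 2 * i - 1"
    using Suc.IH by auto
  have between: "?p j = ?p (2 * i)" if "?s i \<le> j" "j \<le> 2 * i" for j
  proof -
    have "j = ?s i \<or> j = 2 * i"
      using that s by linarith
    then show ?thesis
      using ps by blast
  qed
  have sgn: "?p (2 * i) = 1 \<or> ?p (2 * i) = - 1"
    unfolding p0 using f0 by (cases "even i") auto
  have "?p (2 * i + 2) \<noteq> ?p (2 * i)"
    using sgn p0 p2 by auto
  show ?case
  proof (cases "run_shift f (Suc i) = 1")
    case True
    then have p1: "?p (2 * i + 1) = ?p (2 * i)"
      using shift sgn by auto
    have "?s (Suc i) = 2 * i + 2"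
      unfolding run_start.simps ps
    proof (rule Least_equality)
      show "?s i < 2 * i + 2 \<and> ?p (2 * i + 2) \<noteq> ?p (2 * i)"
        using s \<open>?p (2 * i + 2) \<noteq> ?p (2 * i)\<close> by simp
      show "2 * i + 2 \<le> j" if "?s i < j \<and> ?p j \<noteq> ?p (2 * i)" for j
      proof (rule ccontr)
        assume "\<not> 2 * i + 2 \<le> j"
        then have "j \<le> 2 * i \<or> j = 2 * i + 1"
          by linarith
        then show False
          using that between[of j] p1 by auto
      qed
    qed
    then show ?thesis
      using True by simp
  next
    case False
    then have "run_shift f (Suc i) = - 1"
      using run_shift_sign[OF f, of "Suc i"] by simp
    then have p1: "?p (2 * i + 1) = - ?p (2 * i)"
      using shift sgn by auto
    have "?s (Suc i) = 2 * i + 1"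
      unfolding run_start.simps ps
    proof (rule Least_equality)
      show "?s i < 2 * i + 1 \<and> ?p (2 * i + 1) \<noteq> ?p (2 * i)"
        using s p1 sgn by auto
      show "2 * i + 1 \<le> j" if "?s i < j \<and> ?p j \<noteq> ?p (2 * i)" for j
        using that between[of j] by (cases "j \<le> 2 * i") auto
    qed
    then show ?thesis
      using False p0 p1 p2 by simp
  qed
qed

lemma run_lengths_inf_paperfold_inf:
  assumes "range f \<subseteq> {-1, 1}"
  shows "2 * int (run_lengths_inf (paperfold_inf f) i) = 4 + run_shift f (Suc i) - run_shift f i"
proof -
  \<comment> \<open>For \<open>i = 0\<close> the start \<open>2 * i - 1\<close> would be truncated
    to 0; this rules that branch out.\<close>
  have "i = 0 \<Longrightarrow> run_shift f i = 1"
    by (simp add: run_shift_def)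
  then show ?thesis
    unfolding run_lengths_inf_def
    using run_start_paperfold_inf[OF assms, of i] run_start_paperfold_inf[OF assms, of "Suc i"]
      run_shift_sign[OF assms, of i] run_shift_sign[OF assms, of "Suc i"]
    by (cases "i = 0") (auto simp del: run_start.simps)
qed

section \<open>From squares of run lengths to overlaps\<close>

lemma run_lengths_inf_square:
  assumes f: "range f \<subseteq> {-1, 1}" and "z \<noteq> []"
    and "factor_inf (z @ z) (run_lengths_inf (paperfold_inf f))"
  shows "z @ z \<in> {[2, 2], [1, 2, 3, 1, 2, 3], [3, 2, 1, 3, 2, 1]}"
proof -
  let ?r = "run_lengths_inf (paperfold_inf f)" and ?E = "run_shift f"
  define n where "n = length z"
  have n: "n > 0"
    using assms(2) by (simp add: n_def)
  obtain i where zz: "z @ z = map ?r [i..<i + 2 * n]"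
    using assms(3) by (auto simp: factor_inf_def n_def mult_2)
  note r = run_lengths_inf_paperfold_inf[OF f] and sgn = run_shift_sign[OF f]
  have per: "?r (i + t) = ?r (i + t + n)" if "t < n" for t
  proof -
    have "?r (i + t) = (z @ z) ! t" "?r (i + t + n) = (z @ z) ! (t + n)"
      unfolding zz using that by (simp_all add: ac_simps)
    then show ?thesis
      using that by (simp add: nth_append n_def)
  qed
  \<comment> \<open>Equal run lengths are equal increments of \<open>?E\<close>. Summing
    \<open>n\<close> of them relates \<open>n + 1\<close> indices, one more than a square
    does.\<close>
  have const: "?E (i + t + n) - ?E (i + t) = ?E (i + n) - ?E i" if "t \<le> n" for t
    using that
  proof (induction t)
    case (Suc t)
    then show ?case
      using per[of t] r[of "i + t"] r[of "i + t + n"] by simp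
  qed simp
  \<comment> \<open>\<open>?E i\<close>, \<open>?E (i + n)\<close> and \<open>?E (i + n + n)\<close>
    form an arithmetic progression of signs, so the difference is 0.\<close>
  have zero: "?E (i + n) = ?E i"
    using const[of n] sgn[of i] sgn[of "i + n"] sgn[of "i + n + n"] by auto
  have ov: "?E (j + n) = ?E j" if "i \<le> j" "j \<le> i + n" for j
    using const[of "j - i"] zero that by simp
  have E: "dyadic_alternating ?E"
    by (rule dyadic_alternating_run_shift[OF f])
  consider "n = 1" | "n = 3"
    using overlap_period[OF E n] ov by blast
  then show ?thesis
  proof cases
    case 1
    have "?E (i + 1) = ?E i" "?E (i + 2) = ?E (i + 1)"
      using ov[of i] ov[of "i + 1"] by (simp_all add: 1)
    then have "?r i = 2" "?r (Suc i) = 2"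
      using r[of i] r[of "Suc i"] by simp_all
    then show ?thesis
      unfolding zz 1 by (simp add: upt_conv_Cons)
  next
    case 2
    have e: "?E (i + 1) = - ?E i" "?E (i + 2) = - ?E i"
      using overlap_period_3[OF E, of i] ov by (simp_all add: 2)
    have e3: "?E (i + 3) = ?E i" "?E (i + 4) = ?E (i + 1)" "?E (i + 5) = ?E (i + 2)"
      "?E (i + 6) = ?E (i + 3)"
      using ov[of i] ov[of "i + 1"] ov[of "i + 2"] ov[of "i + 3"]
      by (simp_all add: 2 numeral_eq_Suc)
    have r6: "2 * int (?r i) = 4 + ?E (i + 1) - ?E i"
      "2 * int (?r (i + 1)) = 4 + ?E (i + 2) - ?E (i + 1)"
      "2 * int (?r (i + 2)) = 4 + ?E (i + 3) - ?E (i + 2)"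
      "2 * int (?r (i + 3)) = 4 + ?E (i + 4) - ?E (i + 3)"
      "2 * int (?r (i + 4)) = 4 + ?E (i + 5) - ?E (i + 4)"
      "2 * int (?r (i + 5)) = 4 + ?E (i + 6) - ?E (i + 5)"
      using r[of i] r[of "i + 1"] r[of "i + 2"] r[of "i + 3"] r[of "i + 4"] r[of "i + 5"]
      by (simp_all add: numeral_eq_Suc)
    have "map ?r [i..<i + 6] =
      [?r i, ?r (i + 1), ?r (i + 2), ?r (i + 3), ?r (i + 4), ?r (i + 5)]"
      by (simp add: upt_conv_Cons numeral_eq_Suc)
    then have zz6: "z @ z = [?r i, ?r (i + 1), ?r (i + 2), ?r (i + 3), ?r (i + 4), ?r (i + 5)]"
      unfolding zz 2 by simp
    from sgn[of i] show ?thesis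
    proof
      assume "?E i = 1"
      then have "?r i = 1 \<and> ?r (i + 1) = 2 \<and> ?r (i + 2) = 3 \<and>
        ?r (i + 3) = 1 \<and> ?r (i + 4) = 2 \<and> ?r (i + 5) = 3"
        using e e3 r6 by linarith
      then show ?thesis
        unfolding zz6 by simp
    next
      assume "?E i = - 1"
      then have "?r i = 3 \<and> ?r (i + 1) = 2 \<and> ?r (i + 2) = 1 \<and>
        ?r (i + 3) = 3 \<and> ?r (i + 4) = 2 \<and> ?r (i + 5) = 1"
        using e e3 r6 by linarith
      then show ?thesis
        unfolding zz6 by simp
    qed
  qed
qed

section \<open>Finite words\<close>

text \<open>The condition at \<open>b\<close> makes it a run boundary, so cutting there does not
  shorten the last run.\<close>

lemma run_lengths_map_upt:
  assumes p: "\<And>i. \<exists>j>i. p j \<noteq> p i"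
    and "run_start p k < b" "p b \<noteq> p (b - 1)"
  shows "\<exists>m. run_lengths (map p [run_start p k..<b]) = map (run_lengths_inf p) [k..<m]"
  using assms(2,3)
proof (induction "b - run_start p k" arbitrary: k rule: less_induct)
  case less
  let ?a = "run_start p k" and ?c = "run_start p (Suc k)"
  note S = run_start_Suc[of p, OF p, of k]
  have cb: "?c \<le> b"
  proof (rule ccontr)
    assume "\<not> ?c \<le> b"
    then show False
      using S(3)[of b] S(3)[of "b - 1"] less.prems by auto
  qed
  have split: "map p [?a..<b] = p ?a # map p [Suc ?a..<?c] @ map p [?c..<b]"
  proof -
    have "[?a..<b] = ?a # [Suc ?a..<?c] @ [?c..<b]"
      using S(1) cb upt_add_eq_append[of ?a ?c "b - ?c"] by (simp add: upt_conv_Cons del: run_start.simps)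
    then show ?thesis
      by simp
  qed
  have same: "\<forall>y\<in>set (map p [Suc ?a..<?c]). y = p ?a"
  proof
    fix y
    assume "y \<in> set (map p [Suc ?a..<?c])"
    then obtain i where "y = p i" "Suc ?a \<le> i" "i < ?c"
      by (auto simp del: run_start.simps)
    then show "y = p ?a"
      using S(3)[OF Suc_leD] by blast
  qed
  have "takeWhile (\<lambda>y. y = x) ys = []" "dropWhile (\<lambda>y. y = x) ys = ys"
    if "ys \<noteq> [] \<Longrightarrow> hd ys \<noteq> x" for x :: 'a and ys
    using that by (cases ys; simp)+
  note this[of "map p [?c..<b]" "p ?a"]
  moreover have "hd (map p [?c..<b]) = p ?c" if "map p [?c..<b] \<noteq> []"
    using that by (simp add: hd_map del: run_start.simps)
  ultimately have hd: "takeWhile (\<lambda>y. y = p ?a) (map p [?c..<b]) = []"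
    "dropWhile (\<lambda>y. y = p ?a) (map p [?c..<b]) = map p [?c..<b]"
    using S(2) by metis+
  have len: "Suc (length (map p [Suc ?a..<?c])) = run_lengths_inf p k"
    using S(1) by (simp add: run_lengths_inf_def Suc_diff_Suc del: run_start.simps)
  have tw: "takeWhile (\<lambda>y. y = x) (ys @ zs) = ys @ takeWhile (\<lambda>y. y = x) zs"
    "dropWhile (\<lambda>y. y = x) (ys @ zs) = dropWhile (\<lambda>y. y = x) zs"
    if "\<forall>y\<in>set ys. y = x" for x :: 'a and ys zs
    using that by (simp_all add: takeWhile_append dropWhile_append)
  have rl: "run_lengths (map p [?a..<b]) = run_lengths_inf p k # run_lengths (map p [?c..<b])"
    unfolding split run_lengths.simps tw[OF same] hd append_Nil2 len ..
  show ?case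
  proof (cases "?c = b")
    case True
    then have "run_lengths (map p [?a..<b]) = map (run_lengths_inf p) [k..<Suc k]"
      unfolding rl by simp
    then show ?thesis
      by blast
  next
    case False
    then have "?c < b"
      using cb by simp
    then obtain m where m: "run_lengths (map p [?c..<b]) = map (run_lengths_inf p) [Suc k..<m]"
      using less.hyps[of "Suc k"] diff_less_mono2[OF S(1), of b] S(1) less.prems(2)
      by (metis less_trans)
    show ?thesis
    \<comment> \<open>If \<open>[Suc k..<m]\<close> is empty, \<open>m\<close> may be at most
      \<open>k\<close>; then \<open>Suc k\<close> serves as the bound.\<close>
    proof (cases "k < m")
      case True
      then have "run_lengths (map p [?a..<b]) = map (run_lengths_inf p) [k..<m]"
        unfolding rl m by (simp add: upt_conv_Cons)
      then show ?thesis
        by blast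
    next
      case False
      then have "run_lengths (map p [?a..<b]) = map (run_lengths_inf p) [k..<Suc k]"
        unfolding rl m by simp
      then show ?thesis
        by blast
    qed
  qed
qed

text \<open>The instruction following \<open>f\<close> is chosen so as to end the last run of \<open>paperfold f\<close>.\<close>

lemma run_lengths_paperfold_prefix:
  assumes f: "set f \<subseteq> {-1, 1}"
  shows "\<exists>g m. range g \<subseteq> {-1, 1} \<and>
    run_lengths (paperfold f) = map (run_lengths_inf (paperfold_inf g)) [0..<m]"
proof (cases "f = []")
  case True
  then show ?thesis
    by (intro exI[of _ "\<lambda>_. 1"] exI[of _ 0]) simp
next
  case False
  define n where "n = length f"
  define w where "w = paperfold f"
  define g where "g i = (if i < n then f ! i else if last w = 1 then - 1 else 1)" for i
  have "f ! i \<in> {-1, 1}" if "i < n" for i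
    using f nth_mem[of i f] that unfolding n_def by blast
  then have "g i \<in> {-1, 1}" for i
    unfolding g_def by simp
  then have g: "range g \<subseteq> {-1, 1}"
    by blast
  have "map g [0..<n] = f"
    by (rule nth_equalityI) (simp_all add: g_def n_def)
  then have pre: "prefix_inf w (paperfold_inf g)"
    using prefix_paperfold_inf[of g n] by (simp add: w_def)
  have len: "length w = 2 ^ n - 1" and n: "n > 0"
    using length_paperfold[of f] False by (simp_all add: w_def n_def)
  have "(2::nat) ^ n \<ge> 2"
    using n by (metis Suc_leI one_le_numeral power_increasing power_one_right One_nat_def)
  then have wpos: "length w > 0"
    using len by simp
  have w: "w = map (paperfold_inf g) [0..<length w]"
    using pre by (intro nth_equalityI) (simp_all add: prefix_inf_def)
  have "paperfold_inf g (length w - 1) = last w"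
    using pre wpos by (simp add: prefix_inf_def last_conv_nth)
  \<comment> \<open>Index \<open>length w = 2 ^ n - 1\<close> holds the instruction
    \<open>g n\<close> itself, the first one beyond \<open>f\<close>.\<close>
  moreover have "paperfold_inf g (length w) = (if last w = 1 then - 1 else 1)"
    unfolding len paperfold_inf_power by (simp add: g_def)
  ultimately have "paperfold_inf g (length w) \<noteq> paperfold_inf g (length w - 1)"
    by auto
  then obtain m where
    "run_lengths (map (paperfold_inf g) [0..<length w]) = map (run_lengths_inf (paperfold_inf g)) [0..<m]"
    using run_lengths_map_upt[OF paperfold_inf_changes[OF g], of 0 "length w"] wpos by auto
  then show ?thesis
    using g w unfolding w_def by metis
qed

lemma sublist_map_upt_factor_inf:
  assumes "sublist w (map r [0..<m])"
  shows "factor_inf w r"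
proof -
  obtain us vs where eq: "map r [0..<m] = us @ w @ vs"
    using assms by (auto simp: sublist_def)
  have m: "m = length us + length w + length vs"
    using arg_cong[OF eq, of length] by simp
  have "w = map r [length us..<length us + length w]"
  proof (rule nth_equalityI)
    fix t
    assume "t < length w"
    then show "w ! t = map r [length us..<length us + length w] ! t"
      using arg_cong[OF eq, of "\<lambda>x. x ! (length us + t)"] m by (simp add: nth_append)
  qed simp
  then show ?thesis
    unfolding factor_inf_def by blast
qed

theorem theorem6:
  shows "(\<forall>f :: int list. set f \<subseteq> {-1, 1} \<longrightarrow>
            (\<forall>z. z \<noteq> [] \<and> sublist (z @ z) (run_lengths (paperfold f)) \<longrightarrow>
                 z @ z \<in> {[2, 2], [1, 2, 3, 1, 2, 3], [3, 2, 1, 3, 2, 1]})) \<and>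
         (\<forall>f :: nat \<Rightarrow> int. range f \<subseteq> {-1, 1} \<longrightarrow>
            (\<forall>z. z \<noteq> [] \<and> factor_inf (z @ z) (run_lengths_inf (paperfold_inf f)) \<longrightarrow>
                 z @ z \<in> {[2, 2], [1, 2, 3, 1, 2, 3], [3, 2, 1, 3, 2, 1]}))"
proof (intro conjI allI impI; elim conjE)
  fix f :: "int list" and z
  assume "set f \<subseteq> {-1, 1}" and z: "z \<noteq> []" "sublist (z @ z) (run_lengths (paperfold f))"
  then obtain g m where g: "range g \<subseteq> {-1, 1}"
    "run_lengths (paperfold f) = map (run_lengths_inf (paperfold_inf g)) [0..<m]"
    using run_lengths_paperfold_prefix by blast
  show "z @ z \<in> {[2, 2], [1, 2, 3, 1, 2, 3], [3, 2, 1, 3, 2, 1]}"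
    using run_lengths_inf_square[OF g(1) z(1)] sublist_map_upt_factor_inf z(2) g(2) by metis
qed (rule run_lengths_inf_square)

end
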